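(* Let $K_i$ be the spacetime tent over the vertex patch $\Omega_{v^{(i)}}$ between the fronts $\tau_{i-1}$ and $\tau_i=\tau_{i-1}+k_i\eta_i$, let $\hat K_i=\Omega_{v^{(i)}}\times(0,1)$, let $\Phi:\hat K_i\to K_i$ be given by $\Phi(\hat x,\hat t)=(\hat x,\varphi(\hat x,\hat t))$ with $\varphi(\hat x,\hat t)=(1-\hat t)\tau_{i-1}(\hat x)+\hat t\,\tau_i(\hat x)$, and let $\delta=\tau_i-\tau_{i-1}$. Put $\hat u=u\circ\Phi$ and $$\hat U(\hat x,\hat t)=\hat G(\hat x,\hat t,\hat u(\hat x,\hat t)),\qquad \hat G(\hat x,\hat t,w)=\hat g(\hat x,\hat t,w)-\hat f(\hat x,\hat t,w)\,\hat{\mathrm{grad}}\,\varphi,$$ where $\hat f(\hat x,\hat t,w)=f(\Phi(\hat x,\hat t),w)$, $\hat g(\hat x,\hat t,w)=g(\Phi(\hat x,\hat t),w)$ and $\hat b(\hat x,\hat t,w)=b(\Phi(\hat x,\hat t),w)$. The function $u$ satisfies $$\partial_t g(x,t,u)+\mathrm{div}_x f(x,t,u)+b(x,t,u)=0\quad\text{in }K_i$$ if and only if $\hat u$ and $\hat U$ satisfy $$\hat\partial_t\hat U+\hat{\mathrm{div}}\big(\delta\hat f\,\big)+\delta\,\hat b=0\quad\text{in }\hat K_i,$$ which in expanded component form reads $$\hat\partial_t\big[\hat G(\hat u)\big]_l+\sum_{j=1}^N\hat\partial_j\Big(\delta(\hat x)\,\hat f_{lj}(\hat x,\hat t,\hat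 u(\hat x,\hat t))\Big)+\delta(\hat x)\,\hat b_l(\hat x,\hat t,\hat u(\hat x,\hat t))=0$$ for all $(\hat x,\hat t)$ in $\hat K_i$ and all $l=1,\dots,L$, where $\hat G(\hat u)$ abbreviates $\hat G(\hat x,\hat t,\hat u(\hat x,\hat t))$.
   Context: Let $L,N\ge 1$ be integers, $\Omega_0\subset\mathbb R^N$ a spatial domain and $\Omega=\Omega_0\times(0,t_{\max})$. The functions $f:\Omega\times\mathbb R^L\to\mathbb R^{L\times N}$, $g:\Omega\times\mathbb R^L\to\mathbb R^L$, $b:\Omega\times\mathbb R^L\to\mathbb R^L$ are given and sufficiently regular, and the unknown $u$ takes values in $\mathbb R^L$. The system $\partial_t g(x,t,u)+\mathrm{div}_x f(x,t,u)+b(x,t,u)=0$ means $\partial_t g_l(x,t,u(x,t))+\sum_{j=1}^N\partial_j\big(f_{lj}(x,t,u(x,t))\big)+b_l(x,t,u(x,t))=0$ for $l=1,\dots,L$, where $\partial_t=\partial/\partial t$, $\partial_j=\partial/\partial x_j$ (the spatial divergence $\mathrm{div}_x$ is applied row-wise). The system is assumed to be hyperbolic in the $t$-direction; in particular, for any fixed $x,t,u$ the $L\times L$ matrix $D_ug$ of derivatives of $g$ with respect to $u$ is invertible. Mesh and tent: $\mathcal T$ is a simplicial conforming shape regular finite element mesh of $\Omega_0$, and $P_1(\mathcal T)$ is the set of continuous real-valued functions on $\Omega_0$ that are linear on each element of $\mathcal T$. For a mesh vertex $v$, the vertex patch $\Omega_v$ is the open set that is the interior of the union of all simplices of $\mathcal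 T$ connected to $v$. Given a mesh vertex $v^{(i)}$, an advancing front $\tau_{i-1}\in P_1(\mathcal T)$ and a tent pole height $k_i>0$, let $\eta_i\in P_1(\mathcal T)$ be the function equal to $1$ at $v^{(i)}$ and $0$ at all other mesh vertices, and set $\tau_i=\tau_{i-1}+k_i\eta_i$. The tent, a subset of $\Omega$, is $$K_i=\{(x,t):x\in\Omega_{v^{(i)}},\ \tau_{i-1}(x)<t<\tau_i(x)\}.$$ Notation on $\hat K_i$: $\hat\partial_j=\partial/\partial\hat x_j$, $\hat\partial_t=\partial/\partial\hat t$; $\hat{\mathrm{grad}}\,\varphi$ is the column vector with entries $\hat\partial_1\varphi,\dots,\hat\partial_N\varphi$; $\hat f\,\hat{\mathrm{grad}}\,\varphi$ is the product of the $L\times N$ matrix $\hat f$ with this vector; in the mapped equation $\hat{\mathrm{div}}$ is the row-wise spatial divergence in $\hat x$, and $\hat f,\hat b$ are evaluated at $(\hat x,\hat t,\hat u(\hat x,\hat t))$. *)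

theory Defs
  imports "HOL-Analysis.Analysis"
begin

text \<open>
  Spacetime points are pairs \<open>(x, t)\<close>. An \<open>L \<times> N\<close> matrix has type \<open>real ^ 'n ^ 'l\<close>, so
  \<open>A $ l $ j\<close> is the entry in row \<open>l\<close> and column \<open>j\<close>.
\<close>

definition inradius :: "(real ^ 'n) set \<Rightarrow> real" where
  "inradius T = Sup {r. \<exists>c. cball c r \<subseteq> T}"

definition shape_regular :: "real \<Rightarrow> (real ^ 'n) set set \<Rightarrow> bool" where
  "shape_regular \<sigma> \<T> \<longleftrightarrow> (\<forall>T\<in>\<T>. diameter T \<le> \<sigma> * inradius T)"

text \<open>
  The elements are the closed \<open>N\<close>-dimensional simplices; conformity is the requirement in
  \<^const>\<open>triangulation\<close> that two elements meet in a common face (possibly empty).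
\<close>

definition fe_mesh :: "(real ^ 'n) set \<Rightarrow> real \<Rightarrow> (real ^ 'n) set set \<Rightarrow> bool" where
  "fe_mesh \<Omega>\<^sub>0 \<sigma> \<T> \<longleftrightarrow>
     triangulation \<T> \<and> (\<forall>T\<in>\<T>. int CARD('n) simplex T) \<and>
     \<Union>\<T> = closure \<Omega>\<^sub>0 \<and> shape_regular \<sigma> \<T>"

definition mesh_vertices :: "(real ^ 'n) set set \<Rightarrow> (real ^ 'n) set" where
  "mesh_vertices \<T> = {v. \<exists>T\<in>\<T>. v extreme_point_of T}"

definition vertex_patch :: "(real ^ 'n) set set \<Rightarrow> real ^ 'n \<Rightarrow> (real ^ 'n) set" where
  "vertex_patch \<T> v = interior (\<Union>{T\<in>\<T>. v \<in> T})"

text \<open>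
  The functions are taken on the closed domain \<open>\<Union>\<T>\<close>, so that values at boundary vertices make
  sense. ``Linear'' has the finite element meaning of a polynomial of degree at most one.
\<close>

definition P1 :: "(real ^ 'n) set set \<Rightarrow> (real ^ 'n \<Rightarrow> real) set" where
  "P1 \<T> = {h. continuous_on (\<Union>\<T>) h \<and> (\<forall>T\<in>\<T>. \<exists>a c. \<forall>x\<in>T. h x = a \<bullet> x + c)}"

definition tent ::
  "(real ^ 'n) set set \<Rightarrow> real ^ 'n \<Rightarrow> (real ^ 'n \<Rightarrow> real) \<Rightarrow> (real ^ 'n \<Rightarrow> real) \<Rightarrow> ((real ^ 'n) \<times> real) set"
  where
  "tent \<T> v \<tau>\<^sub>0 \<tau>\<^sub>1 = {(x, t). x \<in> vertex_patch \<T> v \<and> \<tau>\<^sub>0 x < t \<and> t < \<tau>\<^sub>1 x}"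

definition deriv_t :: "((real ^ 'n) \<times> real \<Rightarrow> 'a::real_normed_vector) \<Rightarrow> (real ^ 'n) \<times> real \<Rightarrow> 'a" where
  "deriv_t h p = vector_derivative (\<lambda>s. h (fst p, s)) (at (snd p))"

text \<open>
  Spatial derivatives are taken relative to a set \<open>S\<close>. For \<open>S = UNIV\<close>, and at points of the
  interior of \<open>S\<close>, \<open>deriv_x S j\<close> is the usual \<open>j\<close>-th partial derivative of a differentiable
  function. For an element \<open>S = T\<close> it is also defined on the boundary of \<open>T\<close>, where the function
  need only be differentiable from within \<open>T\<close>: the total derivative relative to \<open>T\<close> is unique at
  every point of \<open>T\<close>, because \<open>T\<close> is convex with nonempty interior. This gives a meaning to the
  gradient of a function in \<open>P1 \<T>\<close> at every point of the domain, one for each element that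
  contains the point.
\<close>

definition deriv_x ::
  "(real ^ 'n) set \<Rightarrow> 'n \<Rightarrow> ((real ^ 'n) \<times> real \<Rightarrow> real) \<Rightarrow> (real ^ 'n) \<times> real \<Rightarrow> real" where
  "deriv_x S j h p = frechet_derivative (\<lambda>y. h (y, snd p)) (at (fst p) within S) (axis j 1)"

definition grad_x ::
  "(real ^ 'n) set \<Rightarrow> ((real ^ 'n) \<times> real \<Rightarrow> real) \<Rightarrow> (real ^ 'n) \<times> real \<Rightarrow> real ^ 'n" where
  "grad_x S h p = (\<chi> j. deriv_x S j h p)"

definition div_x ::
  "(real ^ 'n) set \<Rightarrow> ((real ^ 'n) \<times> real \<Rightarrow> real ^ 'n ^ 'l) \<Rightarrow> (real ^ 'n) \<times> real \<Rightarrow> real ^ 'l" where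
  "div_x S F p = (\<chi> l. \<Sum>j\<in>UNIV. deriv_x S j (\<lambda>q. F q $ l $ j) p)"

end

theory Submission
  imports Defs
begin

text \<open>
  On an element \<open>T\<close> the fronts are affine, so \<open>\<nabla>\<phi> = a + t c\<close> with constant vectors \<open>a\<close> and
  \<open>c = \<nabla>\<delta>\<close>. Since \<open>\<partial>\<^sub>t \<phi> = \<delta>\<close>, the chain rule shows that the mapped residual at \<open>(x, t)\<close> is
  \<open>\<delta>(x)\<close> times the original residual at \<open>\<Phi>(x, t)\<close>: the terms \<open>f \<nabla>\<delta>\<close> and \<open>\<delta> (\<partial>\<^sub>t f) \<nabla>\<phi>\<close> occur
  with opposite signs in the time derivative and in the divergence and cancel. As \<open>\<delta>\<close> is positive on
  the vertex patch, \<open>\<Phi>\<close> maps the cylinder onto the tent and the factor can be divided out.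
\<close>

section \<open>Derivatives relative to a convex set with interior, and componentwise
  derivatives\<close>

lemma has_derivative_within_convex_unique:
  fixes f :: "'a::euclidean_space \<Rightarrow> 'b::real_normed_vector"
  assumes S: "convex S" "interior S \<noteq> {}" "x \<in> S"
    and A: "(f has_derivative A) (at x within S)"
    and B: "(f has_derivative B) (at x within S)"
  shows "A = B"
proof -
  define D where "D = (\<lambda>h. A h - B h)"
  have D: "((\<lambda>_. 0) has_derivative D) (at x within S)"
    using has_derivative_diff[OF A B] by (simp add: D_def)
  then interpret D: bounded_linear D
    by (rule has_derivative_bounded_linear)
  \<comment> \<open>Convexity keeps the segment from \<open>x\<close> to \<open>y\<close> inside
    \<open>S\<close>. Along it the zero function gets the derivative \<open>D (y - x)\<close> at
    parameter 0, and one-variable uniqueness on a closed interval applies even at the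
    endpoint.\<close>
  have dir: "D (y - x) = 0" if "y \<in> S" for y
  proof -
    have sub: "(\<lambda>s. x + s *\<^sub>R (y - x)) ` {0..1} \<subseteq> S"
    proof clarify
      fix s :: real
      assume s: "s \<in> {0..1}"
      have "x + s *\<^sub>R (y - x) = (1 - s) *\<^sub>R x + s *\<^sub>R y"
        by (simp add: algebra_simps)
      then show "x + s *\<^sub>R (y - x) \<in> S"
        using s convexD[OF S(1,3) that, of "1 - s" s] by simp
    qed
    have path: "((\<lambda>s::real. x + s *\<^sub>R (y - x)) has_derivative (\<lambda>s. s *\<^sub>R (y - x))) (at 0 within {0..1})"
      by (auto intro!: derivative_eq_intros)
    have "((\<lambda>_. 0) has_derivative D) (at (x + 0 *\<^sub>R (y - x)) within (\<lambda>s. x + s *\<^sub>R (y - x)) ` {0..1})"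
      using D sub by (auto intro: has_derivative_subset)
    from has_derivative_in_compose[OF path this]
    have "((\<lambda>_. 0) has_vector_derivative D (y - x)) (at (0::real) within {0..1})"
      by (simp add: has_vector_derivative_def D.scaleR)
    moreover have "((\<lambda>_. 0) has_vector_derivative (0::'b)) (at (0::real) within {0..1})"
      by (rule has_vector_derivative_const)
    ultimately show ?thesis
      using vector_derivative_unique_within_closed_interval[of 0 1 0 "\<lambda>_. 0" "D (y - x)" 0] by simp
  qed
  \<comment> \<open>Not every direction \<open>h\<close> points from \<open>x\<close> into
    \<open>S\<close>, but every \<open>h\<close> is up to scaling a difference of two points of an
    interior ball. Linearity of \<open>D\<close> then extends \<open>dir\<close> to all
    \<open>h\<close>; the chosen \<open>s\<close> gives a step of length
    \<open>e / 2\<close>.\<close>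
  obtain c e where e: "e > 0" "ball c e \<subseteq> S"
    using S(2) mem_interior by blast
  have "D h = 0" for h
  proof (cases "h = 0")
    case False
    define s where "s = e / (2 * norm h)"
    have s: "s > 0"
      using False e by (simp add: s_def)
    have "norm (s *\<^sub>R h) < e"
      using False e by (simp add: s_def)
    then have "c + s *\<^sub>R h \<in> S" "c \<in> S"
      using e by (auto simp: subset_iff dist_norm)
    then have "D (c + s *\<^sub>R h - x) - D (c - x) = 0"
      by (simp add: dir)
    then have "s *\<^sub>R D h = 0"
      by (simp add: D.scaleR[symmetric] D.diff[symmetric])
    then show ?thesis
      using s by simp
  qed (simp add: D.zero)
  then show ?thesis
    by (auto simp: D_def fun_eq_iff)
qed

text \<open>\<open>frechet_derivative\<close> is a chosen derivative, so a computed one can replace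
  it only where derivatives are unique. All spatial derivatives below are evaluated this way, with
  \<open>S\<close> an element or \<open>UNIV\<close>.\<close>

lemma deriv_x_eqI:
  assumes "convex S" "interior S \<noteq> {}" "x \<in> S"
    and D: "((\<lambda>y. h (y, t)) has_derivative D) (at x within S)"
  shows "deriv_x S j h (x, t) = D (axis j 1)"
proof -
  have "((\<lambda>y. h (y, t)) has_derivative frechet_derivative (\<lambda>y. h (y, t)) (at x within S)) (at x within S)"
    using D differentiableI frechet_derivative_works by blast
  then show ?thesis
    using has_derivative_within_convex_unique[OF assms(1-3) D] by (simp add: deriv_x_def)
qed

lemma deriv_t_eqI:
  assumes "((\<lambda>s. h (x, s)) has_vector_derivative D) (at t)"
  shows "deriv_t h (x, t) = D"
  using assms by (simp add: deriv_t_def vector_derivative_at)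

lemma has_vector_derivative_vec_lambda:
  fixes h :: "real \<Rightarrow> real ^ 'l"
  assumes "\<And>l. ((\<lambda>s. h s $ l) has_vector_derivative D l) (at t)"
  shows "(h has_vector_derivative (\<chi> l. D l)) (at t)"
  unfolding has_vector_derivative_def
  by (subst has_derivative_componentwise_within)
    (use assms in \<open>auto simp: Basis_vec_def inner_axis has_vector_derivative_def\<close>)

text \<open>Differentiability is essential: without it \<open>vector_derivative\<close> is an
  unspecified value, and nothing ties the value for \<open>h\<close> to those for its
  components.\<close>

lemma deriv_t_component:
  fixes h :: "(real ^ 'n) \<times> real \<Rightarrow> real ^ 'l"
  assumes "(\<lambda>s. h (fst p, s)) differentiable (at (snd p))"
  shows "deriv_t (\<lambda>q. h q $ l) p = deriv_t h p $ l"
proof -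
  have "((\<lambda>s. h (fst p, s)) has_vector_derivative deriv_t h p) (at (snd p))"
    using assms by (simp add: deriv_t_def vector_derivative_works)
  then have "((\<lambda>s. h (fst p, s) $ l) has_vector_derivative deriv_t h p $ l) (at (snd p))"
    by (rule bounded_linear.has_vector_derivative[OF bounded_linear_vec_nth])
  then show ?thesis
    by (simp add: deriv_t_def vector_derivative_at)
qed

section \<open>Simplices and piecewise linear functions\<close>

lemma simplex_interior_nonempty:
  fixes T :: "(real ^ 'n) set"
  assumes "int CARD('n) simplex T"
  shows "interior T \<noteq> {}"
proof -
  have "aff_dim T = int DIM(real ^ 'n)"
    using aff_dim_simplex[OF assms] by simp
  \<comment> \<open>Full dimension makes the relative interior, which is nonempty for a nonempty
    convex set, the ordinary interior.\<close>
  then have "affine hull T = UNIV"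
    using aff_dim_eq_full by blast
  moreover have "T \<noteq> {}"
    using \<open>aff_dim T = int DIM(real ^ 'n)\<close> by auto
  ultimately show ?thesis
    using rel_interior_eq_empty[OF convex_simplex[OF assms]] rel_interior_interior[of T] by simp
qed

lemma P1_affine_on_element:
  assumes "h \<in> P1 \<T>" "T \<in> \<T>"
  obtains a c where "\<forall>x\<in>T. h x = a \<bullet> x + c"
proof -
  have "\<exists>a c. \<forall>x\<in>T. h x = a \<bullet> x + c"
    using assms by (simp add: P1_def)
  then show ?thesis
    using that by (elim exE)
qed

lemma P1_has_derivative_on_element:
  assumes "h \<in> P1 \<T>" "T \<in> \<T>"
  obtains a where "\<And>x. x \<in> T \<Longrightarrow> (h has_derivative (\<lambda>y. a \<bullet> y)) (at x within T)"
proof -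
  obtain a c where h: "\<forall>x\<in>T. h x = a \<bullet> x + c"
    using P1_affine_on_element assms .
  have "(h has_derivative (\<lambda>y. a \<bullet> y)) (at x within T)" if "x \<in> T" for x
  proof (rule has_derivative_transform[OF that])
    show "((\<lambda>x. a \<bullet> x + c) has_derivative (\<lambda>y. a \<bullet> y)) (at x within T)"
      by (auto intro!: derivative_eq_intros)
  qed (use h in simp)
  then show ?thesis
    by (rule that)
qed

text \<open>A minimum principle: an element is the convex hull of its extreme points, so a
  half-space containing them contains the element.\<close>

lemma P1_nonneg:
  assumes "h \<in> P1 \<T>" "T \<in> \<T>" "compact T" "convex T"
    and nonneg: "\<And>w. w \<in> mesh_vertices \<T> \<Longrightarrow> 0 \<le> h w"
    and "x \<in> T"
  shows "0 \<le> h x"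
proof -
  obtain a c where h: "\<forall>x\<in>T. h x = a \<bullet> x + c"
    using P1_affine_on_element assms(1,2) .
  have "{x. x extreme_point_of T} \<subseteq> {x. a \<bullet> x \<ge> - c}"
  proof clarify
    fix w
    assume w: "w extreme_point_of T"
    then have "w \<in> T" "0 \<le> h w"
      using nonneg \<open>T \<in> \<T>\<close> by (auto simp: mesh_vertices_def extreme_point_of_def)
    then have "0 \<le> a \<bullet> w + c"
      using h by simp
    then show "a \<bullet> w \<ge> - c"
      by linarith
  qed
  then have "convex hull {x. x extreme_point_of T} \<subseteq> {x. a \<bullet> x \<ge> - c}"
    by (simp add: hull_minimal convex_halfspace_ge)
  then have "x \<in> {x. a \<bullet> x \<ge> - c}"
    using Krein_Milman_Minkowski[OF \<open>compact T\<close> \<open>convex T\<close>] \<open>x \<in> T\<close> by blast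
  then have "0 \<le> a \<bullet> x + c"
    by simp
  then show ?thesis
    using h \<open>x \<in> T\<close> by simp
qed

text \<open>
  Prolonging the segment from \<open>v\<close> to \<open>x\<close> slightly beyond \<open>x\<close> stays in one element at \<open>v\<close>, on which
  \<open>h\<close> is affine and nonnegative; so \<open>h x\<close> is a convex combination giving \<open>h v\<close> positive weight.
\<close>

lemma P1_pos_on_vertex_patch:
  fixes h :: "real ^ 'n \<Rightarrow> real"
  assumes "h \<in> P1 \<T>" and T: "\<And>T. T \<in> \<T> \<Longrightarrow> compact T \<and> convex T"
    and nonneg: "\<And>w. w \<in> mesh_vertices \<T> \<Longrightarrow> 0 \<le> h w"
    and "0 < h v" and "x \<in> vertex_patch \<T> v"
  shows "0 < h x"
proof -
  obtain e where e: "e > 0" "ball x e \<subseteq> \<Union>{T\<in>\<T>. v \<in> T}"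
    using assms(5) unfolding vertex_patch_def mem_interior by (elim exE conjE)
  \<comment> \<open>The added 1 keeps the denominator positive when \<open>x = v\<close> and makes
    \<open>s * norm (x - v) < e\<close> strict, so that \<open>y\<close> stays in the ball.\<close>
  define s where "s = e / (norm (x - v) + 1)"
  have n: "norm (x - v) + 1 > 0"
    by (rule add_nonneg_pos) auto
  then have s: "s > 0"
    using e(1) by (simp add: s_def)
  define y where "y = x + s *\<^sub>R (x - v)"
  have "s * norm (x - v) < s * (norm (x - v) + 1)"
    using s by simp
  also have "\<dots> = e"
    using n by (simp add: s_def)
  finally have "s * norm (x - v) < e" .
  then have "y \<in> ball x e"
    using s by (simp only: y_def mem_ball dist_norm) simp
  then obtain T where "T \<in> \<T>" "v \<in> T" "y \<in> T"
    using e by blast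
  obtain a c where h: "\<forall>x\<in>T. h x = a \<bullet> x + c"
    using P1_affine_on_element assms(1) \<open>T \<in> \<T>\<close> .
  \<comment> \<open>Solving the definition of \<open>y\<close> for \<open>x\<close> shows that
    \<open>x\<close> lies in the same element as \<open>y\<close> and \<open>v\<close>, so one
    affine formula serves all three points.\<close>
  have "x = (1 / (1 + s)) *\<^sub>R y + (s / (1 + s)) *\<^sub>R v"
  proof -
    have "(1 + s) *\<^sub>R x = y + s *\<^sub>R v"
      by (simp add: y_def algebra_simps)
    then have "x = (1 / (1 + s)) *\<^sub>R (y + s *\<^sub>R v)"
      using s by (simp add: eq_vector_fraction_iff)
    then show ?thesis
      by (simp add: scaleR_add_right)
  qed
  moreover have w: "1 / (1 + s) + s / (1 + s) = 1"
    using s by (simp add: add_divide_distrib[symmetric])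
  ultimately have "x \<in> T"
    using convexD[OF T[OF \<open>T \<in> \<T>\<close>, THEN conjunct2] \<open>y \<in> T\<close> \<open>v \<in> T\<close> _ _ w] s by simp
  have "(1 + s) * h x = h y + s * h v"
    using h \<open>x \<in> T\<close> \<open>v \<in> T\<close> \<open>y \<in> T\<close> by (simp add: y_def algebra_simps)
  moreover have "0 \<le> h y"
    by (rule P1_nonneg[OF assms(1) \<open>T \<in> \<T>\<close>]) (use T \<open>T \<in> \<T>\<close> nonneg \<open>y \<in> T\<close> in simp_all)
  ultimately have "0 < (1 + s) * h x"
    using mult_pos_pos[OF s \<open>0 < h v\<close>] by linarith
  moreover have "0 < 1 + s"
    using s by simp
  ultimately show ?thesis
    by (rule zero_less_mult_pos)
qed

text \<open>Openness turns differentiability of \<open>u\<close> on the tent into differentiability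
  at each of its points. The tent is cut out of an open cylinder by two strict inequalities between
  continuous functions.\<close>

lemma open_tent:
  assumes "continuous_on (vertex_patch \<T> v) \<tau>\<^sub>0" "continuous_on (vertex_patch \<T> v) \<tau>\<^sub>1"
  shows "open (tent \<T> v \<tau>\<^sub>0 \<tau>\<^sub>1)"
proof -
  let ?V = "vertex_patch \<T> v \<times> (UNIV :: real set)"
  have V: "open ?V"
    by (simp add: vertex_patch_def open_Times)
  have c: "continuous_on ?V (\<lambda>q. \<tau>\<^sub>0 (fst q))" "continuous_on ?V (\<lambda>q. \<tau>\<^sub>1 (fst q))"
    by (auto intro!: continuous_intros continuous_on_compose2[OF assms(1)] continuous_on_compose2[OF assms(2)])
  have "open (?V \<inter> (\<lambda>q. snd q - \<tau>\<^sub>0 (fst q)) -` {0<..})" "open (?V \<inter> (\<lambda>q. \<tau>\<^sub>1 (fst q) - snd q) -` {0<..})"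
    by (rule continuous_open_preimage, use V c in \<open>auto intro!: continuous_intros\<close>)+
  then have "open ((?V \<inter> (\<lambda>q. snd q - \<tau>\<^sub>0 (fst q)) -` {0<..}) \<inter> (?V \<inter> (\<lambda>q. \<tau>\<^sub>1 (fst q) - snd q) -` {0<..}))"
    by (rule open_Int)
  also have "\<dots> = tent \<T> v \<tau>\<^sub>0 \<tau>\<^sub>1"
    by (auto simp: tent_def)
  finally show ?thesis .
qed

section \<open>Chain rules along tent poles and along fronts\<close>

lemma has_vector_derivative_pole:
  fixes H :: "(real ^ 'n) \<times> real \<Rightarrow> 'a::real_normed_vector"
  assumes H: "(H has_derivative H') (at (x, \<tau> + t * d))"
  shows "((\<lambda>s. H (x, \<tau> + s * d)) has_vector_derivative d *\<^sub>R H' (0, 1)) (at t)"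
proof -
  have "((\<lambda>s. (x, \<tau> + s * d)) has_derivative (\<lambda>s. (0, s * d))) (at t)"
    by (auto intro!: derivative_eq_intros)
  from has_derivative_compose[OF this H]
  have "((\<lambda>s. H (x, \<tau> + s * d)) has_derivative (\<lambda>s. H' (0, s * d))) (at t)" .
  moreover have "H' (0, s * d) = s *\<^sub>R d *\<^sub>R H' (0, 1)" for s
    using linear_scale[OF has_derivative_linear[OF H], of "s * d" "(0, 1)"] by simp
  ultimately show ?thesis
    by (simp add: has_vector_derivative_def)
qed

text \<open>At fixed pseudo-time \<open>t\<close> the front has slope
  \<open>a + t *\<^sub>R c\<close>, so a spatial move also shifts physical time; this produces the
  term with \<open>H' (0, 1)\<close>. The derivative is taken within \<open>T\<close> because the
  front may have kinks across faces.\<close>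

lemma has_derivative_front:
  fixes H :: "(real ^ 'n) \<times> real \<Rightarrow> real"
  assumes H: "(H has_derivative H') (at (x, \<tau> x + t * \<delta> x))"
    and \<tau>: "(\<tau> has_derivative (\<lambda>h. a \<bullet> h)) (at x within T)"
    and \<delta>: "(\<delta> has_derivative (\<lambda>h. c \<bullet> h)) (at x within T)"
  shows "((\<lambda>y. H (y, \<tau> y + t * \<delta> y)) has_derivative
      (\<lambda>h. H' (h, 0) + ((a + t *\<^sub>R c) \<bullet> h) * H' (0, 1))) (at x within T)"
proof -
  have "((\<lambda>y. (y, \<tau> y + t * \<delta> y)) has_derivative (\<lambda>h. (h, (a + t *\<^sub>R c) \<bullet> h))) (at x within T)"
    by (auto intro!: derivative_eq_intros \<tau> \<delta> simp: inner_add_left)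
  from has_derivative_compose[OF this H]
  have "((\<lambda>y. H (y, \<tau> y + t * \<delta> y)) has_derivative (\<lambda>h. H' (h, (a + t *\<^sub>R c) \<bullet> h))) (at x within T)" .
  moreover have lin: "H' (h, r) = H' (h, 0) + r * H' (0, 1)" for h r
    using linear_add[OF has_derivative_linear[OF H], of "(h, 0)" "(0, r)"]
      linear_scale[OF has_derivative_linear[OF H], of r "(0, 1)"] by simp
  have "(\<lambda>h. H' (h, (a + t *\<^sub>R c) \<bullet> h)) = (\<lambda>h. H' (h, 0) + ((a + t *\<^sub>R c) \<bullet> h) * H' (0, 1))"
    by (rule ext) (rule lin)
  ultimately show ?thesis
    by (simp only:)
qed

text \<open>This differentiates the mapped unknown with the gradient of \<open>\<phi>\<close>
  written out as \<open>a + s *\<^sub>R c\<close>. That vector itself varies with \<open>s\<close>,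
  so the product rule contributes the extra terms \<open>F $ l $ j * c $ j\<close>.\<close>

lemma deriv_t_mapped:
  fixes w :: "(real ^ 'n) \<times> real \<Rightarrow> real ^ 'l" and F :: "(real ^ 'n) \<times> real \<Rightarrow> real ^ 'n ^ 'l"
  assumes w: "(w has_derivative w') (at (x, \<tau> + t * d))"
    and F: "(F has_derivative F') (at (x, \<tau> + t * d))"
  shows "((\<lambda>s. w (x, \<tau> + s * d) - F (x, \<tau> + s * d) *v (a + s *\<^sub>R c)) has_vector_derivative
      (\<chi> l. d * w' (0, 1) $ l
        - (\<Sum>j\<in>UNIV. d * F' (0, 1) $ l $ j * (a + t *\<^sub>R c) $ j + F (x, \<tau> + t * d) $ l $ j * c $ j)))
      (at t)"
proof (rule has_vector_derivative_vec_lambda)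
  fix l
  have w1: "((\<lambda>s. w (x, \<tau> + s * d) $ l) has_real_derivative d * w' (0, 1) $ l) (at t)"
    using bounded_linear.has_vector_derivative[OF bounded_linear_vec_nth has_vector_derivative_pole[OF w]]
    by (simp add: has_real_derivative_iff_has_vector_derivative)
  have F1: "((\<lambda>s. F (x, \<tau> + s * d) $ l $ j) has_real_derivative d * F' (0, 1) $ l $ j) (at t)" for j
    using bounded_linear.has_vector_derivative[OF bounded_linear_vec_nth
        bounded_linear.has_vector_derivative[OF bounded_linear_vec_nth has_vector_derivative_pole[OF F]]]
    by (simp add: has_real_derivative_iff_has_vector_derivative)
  show "((\<lambda>s. (w (x, \<tau> + s * d) - F (x, \<tau> + s * d) *v (a + s *\<^sub>R c)) $ l) has_vector_derivative
      d * w' (0, 1) $ l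
        - (\<Sum>j\<in>UNIV. d * F' (0, 1) $ l $ j * (a + t *\<^sub>R c) $ j + F (x, \<tau> + t * d) $ l $ j * c $ j)) (at t)"
    unfolding has_real_derivative_iff_has_vector_derivative[symmetric]
    by (auto simp: matrix_vector_mult_def intro!: derivative_eq_intros w1 F1 sum.cong)
qed

text \<open>The source term is left out, since it is merely multiplied by \<open>\<delta>\<close>.
  Every derivative is reduced to entries of \<open>w'\<close> and \<open>F'\<close> at one point of
  the tent, after which only algebra of finite sums remains.\<close>

lemma mapped_residual:
  fixes w :: "(real ^ 'n) \<times> real \<Rightarrow> real ^ 'l" and F :: "(real ^ 'n) \<times> real \<Rightarrow> real ^ 'n ^ 'l"
  assumes T: "convex T" "interior T \<noteq> {}" "x \<in> T"
    and \<tau>: "(\<tau> has_derivative (\<lambda>h. a \<bullet> h)) (at x within T)"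
    and \<delta>: "(\<delta> has_derivative (\<lambda>h. c \<bullet> h)) (at x within T)"
    and w: "w differentiable (at (x, \<tau> x + t * \<delta> x))"
    and F: "F differentiable (at (x, \<tau> x + t * \<delta> x))"
  shows "vector_derivative (\<lambda>s. w (x, \<tau> x + s * \<delta> x) - F (x, \<tau> x + s * \<delta> x) *v (a + s *\<^sub>R c)) (at t) $ l
      + (\<Sum>j\<in>UNIV. deriv_x T j (\<lambda>q. \<delta> (fst q) * F (fst q, \<tau> (fst q) + snd q * \<delta> (fst q)) $ l $ j) (x, t))
    = \<delta> x * (deriv_t (\<lambda>q. w q $ l) (x, \<tau> x + t * \<delta> x)
      + (\<Sum>j\<in>UNIV. deriv_x UNIV j (\<lambda>q. F q $ l $ j) (x, \<tau> x + t * \<delta> x)))"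
proof -
  define P where "P = (x, \<tau> x + t * \<delta> x)"
  obtain w' F' where w': "(w has_derivative w') (at P)" and F': "(F has_derivative F') (at P)"
    using w F by (auto simp: differentiable_def P_def)
  have Fc: "((\<lambda>q. F q $ l $ j) has_derivative (\<lambda>h. F' h $ l $ j)) (at P)" for j
    using F' by (intro bounded_linear.has_derivative[OF bounded_linear_vec_nth])
  \<comment> \<open>With base 0 and height 1 the pole map is the identity, so the pole lemma gives
    the plain time derivative.\<close>
  have "((\<lambda>s. w (x, 0 + s * 1) $ l) has_vector_derivative 1 *\<^sub>R w' (0, 1) $ l) (at (\<tau> x + t * \<delta> x))"
    by (rule has_vector_derivative_pole)
      (use w' in \<open>auto simp: P_def intro!: bounded_linear.has_derivative[OF bounded_linear_vec_nth]\<close>)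
  then have wt: "deriv_t (\<lambda>q. w q $ l) P = w' (0, 1) $ l"
    unfolding P_def by (intro deriv_t_eqI) simp
  have Fx: "deriv_x UNIV j (\<lambda>q. F q $ l $ j) P = F' (axis j 1, 0) $ l $ j" for j
    unfolding P_def
  proof (rule deriv_x_eqI[where D = "\<lambda>h. F' (h, 0) $ l $ j"])
    have "((\<lambda>y. (y, \<tau> x + t * \<delta> x)) has_derivative (\<lambda>h. (h, 0))) (at x)"
      by (auto intro!: derivative_eq_intros)
    from has_derivative_compose[OF this Fc[unfolded P_def]]
    show "((\<lambda>y. F (y, \<tau> x + t * \<delta> x) $ l $ j) has_derivative (\<lambda>h. F' (h, 0) $ l $ j)) (at x)" .
  qed auto
  have Fhx: "deriv_x T j (\<lambda>q. \<delta> (fst q) * F (fst q, \<tau> (fst q) + snd q * \<delta> (fst q)) $ l $ j) (x, t)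
      = \<delta> x * (F' (axis j 1, 0) $ l $ j + (a + t *\<^sub>R c) $ j * F' (0, 1) $ l $ j) + c $ j * F P $ l $ j" for j
  proof (subst deriv_x_eqI[OF T])
    show "((\<lambda>y. \<delta> (fst (y, t)) * F (fst (y, t), \<tau> (fst (y, t)) + snd (y, t) * \<delta> (fst (y, t))) $ l $ j) has_derivative
       (\<lambda>h. \<delta> x * (F' (h, 0) $ l $ j + ((a + t *\<^sub>R c) \<bullet> h) * F' (0, 1) $ l $ j)
          + (c \<bullet> h) * F P $ l $ j)) (at x within T)"
      using has_derivative_mult[OF \<delta> has_derivative_front[OF Fc[of j, unfolded P_def] \<tau> \<delta>]]
      by (simp add: P_def)
  qed (simp add: inner_axis)
  have "vector_derivative (\<lambda>s. w (x, \<tau> x + s * \<delta> x) - F (x, \<tau> x + s * \<delta> x) *v (a + s *\<^sub>R c)) (at t) $ l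
      = \<delta> x * w' (0, 1) $ l
        - (\<Sum>j\<in>UNIV. \<delta> x * F' (0, 1) $ l $ j * (a + t *\<^sub>R c) $ j + F P $ l $ j * c $ j)"
    using deriv_t_mapped[OF w'[unfolded P_def] F'[unfolded P_def], THEN vector_derivative_at]
    by (simp add: P_def)
  \<comment> \<open>The cancellation in abstract form: \<open>X\<close> and \<open>Y\<close> stand
    for space and time derivatives of the flux, \<open>A\<close> for the gradient of
    \<open>\<phi>\<close>, \<open>Z\<close> for the flux. The left side is the mapped divergence;
    the first sum on the right is what the time derivative subtracts.\<close>
  moreover have "(\<Sum>j\<in>UNIV. \<delta> x * (X j + A j * Y j) + c $ j * Z j)
      = (\<Sum>j\<in>UNIV. \<delta> x * Y j * A j + Z j * c $ j) + \<delta> x * (\<Sum>j\<in>UNIV. X j)"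
    for X Y Z A :: "'n \<Rightarrow> real"
    unfolding sum_distrib_left sum.distrib[symmetric]
    by (rule sum.cong) (simp_all add: algebra_simps)
  ultimately show ?thesis
    unfolding P_def[symmetric] Fhx Fx wt by (simp only:) (simp add: distrib_left)
qed

lemma grad_x_front:
  assumes "convex T" "interior T \<noteq> {}" "x \<in> T"
    and "(\<tau> has_derivative (\<lambda>h. a \<bullet> h)) (at x within T)"
    and "(\<delta> has_derivative (\<lambda>h. c \<bullet> h)) (at x within T)"
  shows "grad_x T (\<lambda>q. \<tau> (fst q) + snd q * \<delta> (fst q)) (x, s) = a + s *\<^sub>R c"
proof -
  have "deriv_x T j (\<lambda>q. \<tau> (fst q) + snd q * \<delta> (fst q)) (x, s) = (a + s *\<^sub>R c) \<bullet> axis j 1" for j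
    by (rule deriv_x_eqI[OF assms(1-3)])
      (auto intro!: derivative_eq_intros assms(4,5) simp: inner_add_left)
  then show ?thesis
    by (simp add: grad_x_def vec_eq_iff inner_axis)
qed

text \<open>The function is the composition of \<open>f\<close> as a joint map with
  \<open>q \<mapsto> (q, u q)\<close>; openness of the domain gives a derivative at the point rather
  than within a set.\<close>

lemma differentiable_along_graph:
  assumes "(\<lambda>(p, w). f p w) differentiable_on \<Omega> \<times> UNIV" "open \<Omega>" "p \<in> \<Omega>"
    and u: "u differentiable (at p)"
  shows "(\<lambda>q. f q (u q)) differentiable (at p)"
proof -
  have "(\<lambda>(p, w). f p w) differentiable (at (p, u p))"
    using assms(1-3) by (auto simp: differentiable_on_eq_differentiable_at open_Times)
  moreover have "(\<lambda>q. (q, u q)) differentiable (at p)"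
    using u unfolding differentiable_def by (elim exE) (rule exI, rule has_derivative_Pair[OF has_derivative_ident])
  ultimately show ?thesis
    using differentiable_chain_at[of "\<lambda>q. (q, u q)" p "\<lambda>(p, w). f p w"] by (simp add: o_def)
qed

section \<open>Equivalence of the equations on tent and cylinder\<close>

theorem theorem3p1:
  fixes \<Omega>\<^sub>0 :: "(real ^ 'n) set" and t\<^sub>m\<^sub>a\<^sub>x \<sigma> k :: real
    and \<Omega> K K\<^sub>h :: "((real ^ 'n) \<times> real) set"
    and \<T> :: "(real ^ 'n) set set" and v :: "real ^ 'n"
    and \<eta> \<tau>\<^sub>0 \<tau>\<^sub>1 \<delta> :: "real ^ 'n \<Rightarrow> real"
    and \<phi> :: "(real ^ 'n) \<times> real \<Rightarrow> real"
    and \<Phi> :: "(real ^ 'n) \<times> real \<Rightarrow> (real ^ 'n) \<times> real"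
    and f f\<^sub>h :: "(real ^ 'n) \<times> real \<Rightarrow> real ^ 'l \<Rightarrow> real ^ 'n ^ 'l"
    and g g\<^sub>h b b\<^sub>h :: "(real ^ 'n) \<times> real \<Rightarrow> real ^ 'l \<Rightarrow> real ^ 'l"
    and u u\<^sub>h :: "(real ^ 'n) \<times> real \<Rightarrow> real ^ 'l"
    and G\<^sub>h :: "(real ^ 'n) set \<Rightarrow> (real ^ 'n) \<times> real \<Rightarrow> real ^ 'l \<Rightarrow> real ^ 'l"
    and U\<^sub>h :: "(real ^ 'n) set \<Rightarrow> (real ^ 'n) \<times> real \<Rightarrow> real ^ 'l"
  assumes "open \<Omega>\<^sub>0" "connected \<Omega>\<^sub>0" "\<Omega>\<^sub>0 \<noteq> {}"
    and "\<Omega> = \<Omega>\<^sub>0 \<times> {0<..<t\<^sub>m\<^sub>a\<^sub>x}"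
    and "fe_mesh \<Omega>\<^sub>0 \<sigma> \<T>"
    and "v \<in> mesh_vertices \<T>"
    and "\<eta> \<in> P1 \<T>" "\<eta> v = 1" "\<forall>w \<in> mesh_vertices \<T> - {v}. \<eta> w = 0"
    and "\<tau>\<^sub>0 \<in> P1 \<T>" "k > 0" "\<tau>\<^sub>1 = (\<lambda>x. \<tau>\<^sub>0 x + k * \<eta> x)"
    and "K = tent \<T> v \<tau>\<^sub>0 \<tau>\<^sub>1" "K \<subseteq> \<Omega>"
    and "K\<^sub>h = vertex_patch \<T> v \<times> {0<..<1}"
    and "\<phi> = (\<lambda>(x, t). (1 - t) * \<tau>\<^sub>0 x + t * \<tau>\<^sub>1 x)"
    and "\<Phi> = (\<lambda>(x, t). (x, \<phi> (x, t)))"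
    and "\<delta> = (\<lambda>x. \<tau>\<^sub>1 x - \<tau>\<^sub>0 x)"
    and "(\<lambda>(p, w). f p w) differentiable_on \<Omega> \<times> UNIV"
    and "(\<lambda>(p, w). g p w) differentiable_on \<Omega> \<times> UNIV"
    and "\<forall>p\<in>\<Omega>. \<forall>w. invertible (jacobian (g p) (at w))"
    and "u differentiable_on K"
    and "f\<^sub>h = (\<lambda>p w. f (\<Phi> p) w)" "g\<^sub>h = (\<lambda>p w. g (\<Phi> p) w)" "b\<^sub>h = (\<lambda>p w. b (\<Phi> p) w)"
    and "u\<^sub>h = u \<circ> \<Phi>"
    and "G\<^sub>h = (\<lambda>T p w. g\<^sub>h p w - f\<^sub>h p w *v grad_x T \<phi> p)"
    and "U\<^sub>h = (\<lambda>T p. G\<^sub>h T p (u\<^sub>h p))"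
  shows
    "((\<forall>p\<in>K. \<forall>l.
         deriv_t (\<lambda>q. g q (u q) $ l) p
         + (\<Sum>j\<in>UNIV. deriv_x UNIV j (\<lambda>q. f q (u q) $ l $ j) p)
         + b p (u p) $ l = 0)
      \<longleftrightarrow>
      (\<forall>T\<in>\<T>. \<forall>p\<in>K\<^sub>h. fst p \<in> T \<longrightarrow>
         deriv_t (U\<^sub>h T) p
         + div_x T (\<lambda>q. \<delta> (fst q) *\<^sub>R f\<^sub>h q (u\<^sub>h q)) p
         + \<delta> (fst p) *\<^sub>R b\<^sub>h p (u\<^sub>h p) = 0))
     \<and>
     ((\<forall>T\<in>\<T>. \<forall>p\<in>K\<^sub>h. fst p \<in> T \<longrightarrow>
         deriv_t (U\<^sub>h T) p
         + div_x T (\<lambda>q. \<delta> (fst q) *\<^sub>R f\<^sub>h q (u\<^sub>h q)) p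
         + \<delta> (fst p) *\<^sub>R b\<^sub>h p (u\<^sub>h p) = 0)
      \<longleftrightarrow>
      (\<forall>T\<in>\<T>. \<forall>p\<in>K\<^sub>h. fst p \<in> T \<longrightarrow> (\<forall>l.
         deriv_t (\<lambda>q. G\<^sub>h T q (u\<^sub>h q) $ l) p
         + (\<Sum>j\<in>UNIV. deriv_x T j (\<lambda>q. \<delta> (fst q) * f\<^sub>h q (u\<^sub>h q) $ l $ j) p)
         + \<delta> (fst p) * b\<^sub>h p (u\<^sub>h p) $ l = 0)))"
proof -
  have elem: "compact T" "convex T" "interior T \<noteq> {}" if "T \<in> \<T>" for T
  proof -
    have "int CARD('n) simplex T"
      using assms(5) that by (simp add: fe_mesh_def)
    then show "compact T" "convex T" "interior T \<noteq> {}"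
      by (rule compact_simplex convex_simplex simplex_interior_nonempty)+
  qed
  have \<delta>: "\<delta> = (\<lambda>x. k * \<eta> x)"
    using assms(12,18) by simp
  have patch: "vertex_patch \<T> v \<subseteq> \<Union>\<T>"
    unfolding vertex_patch_def by (rule order_trans[OF interior_subset]) auto
  \<comment> \<open>The hat function is 1 at \<open>v\<close> and 0 at the other vertices, so the
    positivity result for vertex patches applies to it; the factor \<open>k\<close> is
    positive.\<close>
  have \<delta>_pos: "0 < \<delta> x" if "x \<in> vertex_patch \<T> v" for x
  proof -
    have "0 \<le> \<eta> w" if "w \<in> mesh_vertices \<T>" for w
      using assms(8,9) that by (cases "w = v") auto
    then have "0 < \<eta> x"
      using P1_pos_on_vertex_patch[of \<eta> \<T> v x] assms(7,8) elem that by simp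
    then show ?thesis
      using \<open>k > 0\<close> by (simp add: \<delta>)
  qed
  have "continuous_on (vertex_patch \<T> v) \<tau>\<^sub>0" "continuous_on (vertex_patch \<T> v) \<eta>"
    using assms(7,10) patch by (auto simp: P1_def intro: continuous_on_subset)
  then have "open K"
    unfolding assms(12,13) by (intro open_tent continuous_intros)
  have "open \<Omega>"
    using assms(1,4) by (simp add: open_Times)
  \<comment> \<open>This form exhibits \<open>\<delta>\<close> as the speed of physical time along a
    pole and matches the chain rule lemmas.\<close>
  have \<phi>: "\<phi> = (\<lambda>q. \<tau>\<^sub>0 (fst q) + snd q * \<delta> (fst q))"
    unfolding assms(12,16,18) by (auto simp: algebra_simps)
  have \<Phi>: "\<Phi> = (\<lambda>q. (fst q, \<tau>\<^sub>0 (fst q) + snd q * \<delta> (fst q)))"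
    unfolding assms(17) \<phi> by auto
  have \<tau>\<^sub>1: "\<tau>\<^sub>1 = (\<lambda>x. \<tau>\<^sub>0 x + \<delta> x)"
    using assms(18) by simp
  have \<Phi>_in: "\<Phi> p \<in> K" if "p \<in> K\<^sub>h" for p
    using that \<delta>_pos[of "fst p"] unfolding assms(13,15) \<tau>\<^sub>1 \<Phi> tent_def by auto
  have \<Phi>_onto: "\<exists>p\<in>K\<^sub>h. \<Phi> p = q" if q: "q \<in> K" for q
  proof -
    obtain x t where xt: "q = (x, t)" "x \<in> vertex_patch \<T> v" "\<tau>\<^sub>0 x < t" "t < \<tau>\<^sub>0 x + \<delta> x"
      using q unfolding assms(13) \<tau>\<^sub>1 tent_def by auto
    have d: "0 < \<delta> x"
      using \<delta>_pos xt(2) .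
    show ?thesis
    proof (rule bexI)
      \<comment> \<open>The pseudo-time solves \<open>\<tau>\<^sub>0 x + s * \<delta> x = t\<close>
        for \<open>s\<close>; the tent inequalities put it strictly between 0 and 1.\<close>
      show "\<Phi> (x, (t - \<tau>\<^sub>0 x) / \<delta> x) = q"
        using xt(1) d by (simp add: \<Phi>)
      show "(x, (t - \<tau>\<^sub>0 x) / \<delta> x) \<in> K\<^sub>h"
        using xt d by (simp add: assms(15))
    qed
  qed

  \<comment> \<open>\<open>w\<close> and \<open>F\<close> are density and flux along
    \<open>u\<close>; \<open>R\<close> is the original residual by components,
    \<open>R\<^sub>h\<close> the mapped residual vector relative to an element.\<close>
  define w where "w = (\<lambda>q. g q (u q))"
  define F where "F = (\<lambda>q. f q (u q))"
  define R where "R = (\<lambda>q l. deriv_t (\<lambda>q. w q $ l) q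
    + (\<Sum>j\<in>UNIV. deriv_x UNIV j (\<lambda>q. F q $ l $ j) q) + b q (u q) $ l)"
  define R\<^sub>h where "R\<^sub>h = (\<lambda>T p. deriv_t (U\<^sub>h T) p
    + div_x T (\<lambda>q. \<delta> (fst q) *\<^sub>R f\<^sub>h q (u\<^sub>h q)) p + \<delta> (fst p) *\<^sub>R b\<^sub>h p (u\<^sub>h p))"
  have diff: "w differentiable (at q)" "F differentiable (at q)" if "q \<in> K" for q
  proof -
    have "u differentiable (at q)" "q \<in> \<Omega>"
      using assms(14,22) \<open>open K\<close> that by (auto simp: differentiable_on_eq_differentiable_at)
    then show "w differentiable (at q)" "F differentiable (at q)"
      unfolding w_def F_def
      using differentiable_along_graph \<open>open \<Omega>\<close> assms(19,20) by blast+
  qed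
  \<comment> \<open>Both facts rest on the same explicit formula for \<open>U\<^sub>h\<close> along
    the pole through \<open>x\<close>; the second is needed for passing to components.\<close>
  have key: "R\<^sub>h T p $ l = \<delta> (fst p) * R (\<Phi> p) l"
    and U_diff: "(\<lambda>s. U\<^sub>h T (fst p, s)) differentiable (at (snd p))"
    if "T \<in> \<T>" "p \<in> K\<^sub>h" "fst p \<in> T" for T p l
  proof -
    obtain x t where p: "p = (x, t)"
      by (cases p)
    have x: "x \<in> T"
      using that p by simp
    obtain a where a: "(\<tau>\<^sub>0 has_derivative (\<lambda>y. a \<bullet> y)) (at x within T)"
      using P1_has_derivative_on_element[OF assms(10) \<open>T \<in> \<T>\<close>] x by metis
    obtain c' where c': "(\<eta> has_derivative (\<lambda>y. c' \<bullet> y)) (at x within T)"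
      using P1_has_derivative_on_element[OF assms(7) \<open>T \<in> \<T>\<close>] x by metis
    define c where "c = k *\<^sub>R c'"
    have c: "(\<delta> has_derivative (\<lambda>y. c \<bullet> y)) (at x within T)"
      unfolding \<delta> c_def by (auto intro!: derivative_eq_intros c')
    note T = elem(2,3)[OF \<open>T \<in> \<T>\<close>] x
    \<comment> \<open>The slopes \<open>a\<close> and \<open>c\<close> serve every real
      \<open>s\<close>, so this is an equality of functions of \<open>s\<close> and can be
      substituted under the time derivative.\<close>
    have U: "U\<^sub>h T (x, s) = w (x, \<tau>\<^sub>0 x + s * \<delta> x) - F (x, \<tau>\<^sub>0 x + s * \<delta> x) *v (a + s *\<^sub>R c)" for s
      unfolding assms(23,24,26-28) \<phi> grad_x_front[OF T a c]
      by (simp add: \<Phi> w_def F_def)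
    have P: "(x, \<tau>\<^sub>0 x + t * \<delta> x) \<in> K"
      using \<Phi>_in[OF \<open>p \<in> K\<^sub>h\<close>] by (simp add: \<Phi> p)
    have f_comp: "(\<delta> (fst q) *\<^sub>R f\<^sub>h q (u\<^sub>h q)) $ l $ j
        = \<delta> (fst q) * F (fst q, \<tau>\<^sub>0 (fst q) + snd q * \<delta> (fst q)) $ l $ j" for q j
      unfolding assms(23,26) by (simp add: \<Phi> F_def)
    have "R\<^sub>h T p $ l = deriv_t (U\<^sub>h T) p $ l
      + (\<Sum>j\<in>UNIV. deriv_x T j (\<lambda>q. \<delta> (fst q) * F (fst q, \<tau>\<^sub>0 (fst q) + snd q * \<delta> (fst q)) $ l $ j) p)
      + \<delta> x * b (\<Phi> p) (u (\<Phi> p)) $ l"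
      unfolding R\<^sub>h_def div_x_def f_comp[symmetric] by (simp add: assms(25,26) p)
    also have "deriv_t (U\<^sub>h T) p = vector_derivative
      (\<lambda>s. w (x, \<tau>\<^sub>0 x + s * \<delta> x) - F (x, \<tau>\<^sub>0 x + s * \<delta> x) *v (a + s *\<^sub>R c)) (at t)"
      by (simp add: deriv_t_def p U)
    finally show "R\<^sub>h T p $ l = \<delta> (fst p) * R (\<Phi> p) l"
      using mapped_residual[OF T a c diff[OF P], of l]
      by (simp add: p R_def \<Phi> distrib_left)
    obtain w' F' where "(w has_derivative w') (at (x, \<tau>\<^sub>0 x + t * \<delta> x))"
        "(F has_derivative F') (at (x, \<tau>\<^sub>0 x + t * \<delta> x))"
      using diff[OF P] by (auto simp: differentiable_def)
    from deriv_t_mapped[OF this]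
    show "(\<lambda>s. U\<^sub>h T (fst p, s)) differentiable (at (snd p))"
      unfolding p fst_conv snd_conv U by (rule differentiableI_vector)
  qed

  \<comment> \<open>At a point on a shared face the original equation yields the mapped one for each
    adjacent element; conversely the mapped equation on a single element containing the point
    suffices.\<close>
  have eq: "(\<forall>q\<in>K. \<forall>l. R q l = 0) \<longleftrightarrow> (\<forall>T\<in>\<T>. \<forall>p\<in>K\<^sub>h. fst p \<in> T \<longrightarrow> R\<^sub>h T p = 0)"
  proof (intro iffI ballI impI allI)
    fix T p
    assume "\<forall>q\<in>K. \<forall>l. R q l = 0" "T \<in> \<T>" "p \<in> K\<^sub>h" "fst p \<in> T"
    then show "R\<^sub>h T p = 0"
      using key \<Phi>_in by (simp add: vec_eq_iff)
  next
    fix q l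
    assume R\<^sub>h: "\<forall>T\<in>\<T>. \<forall>p\<in>K\<^sub>h. fst p \<in> T \<longrightarrow> R\<^sub>h T p = 0" and "q \<in> K"
    then obtain p where p: "p \<in> K\<^sub>h" "\<Phi> p = q"
      using \<Phi>_onto by blast
    then have x: "fst p \<in> vertex_patch \<T> v"
      by (auto simp: assms(15))
    then obtain T where T: "T \<in> \<T>" "fst p \<in> T"
      using patch by blast
    have "\<delta> (fst p) * R q l = 0"
      using key[OF T(1) p(1) T(2), of l] R\<^sub>h T p by simp
    then show "R q l = 0"
      using \<delta>_pos[OF x] by simp
  qed
  \<comment> \<open>The divergence is defined by components, so only the time derivative requires an
    argument, namely \<open>U_diff\<close>.\<close>
  have comp: "R\<^sub>h T p = 0 \<longleftrightarrow> (\<forall>l. deriv_t (\<lambda>q. G\<^sub>h T q (u\<^sub>h q) $ l) p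
         + (\<Sum>j\<in>UNIV. deriv_x T j (\<lambda>q. \<delta> (fst q) * f\<^sub>h q (u\<^sub>h q) $ l $ j) p)
         + \<delta> (fst p) * b\<^sub>h p (u\<^sub>h p) $ l = 0)"
    if "T \<in> \<T>" "p \<in> K\<^sub>h" "fst p \<in> T" for T p
  proof -
    have "deriv_t (\<lambda>q. G\<^sub>h T q (u\<^sub>h q) $ l) p = deriv_t (U\<^sub>h T) p $ l" for l
      using deriv_t_component[OF U_diff[OF that]] by (simp add: assms(28))
    then show ?thesis
      by (simp add: R\<^sub>h_def vec_eq_iff div_x_def)
  qed
  show ?thesis
  proof (rule conjI, goal_cases)
    case 1
    show ?case
      by (rule eq[unfolded R_def R\<^sub>h_def w_def F_def])
  next
    case 2
    show ?case
      by (intro ball_cong imp_cong refl comp[unfolded R\<^sub>h_def])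
  qed
qed

end
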